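(* Let $\{z^k=(x^k,y^k)\}_{k=0}^{\infty}$ be the iterates of PDHG applied to the linear program $\min_{x\ge 0}\max_{y}\; c^Tx-y^TAx+b^Ty$ with step-size $0<s\le \frac{1}{2\|A\|_2}$ and initial point $z^0$, and let $z^*=(x^*,y^* )$ be the optimal solution to which they converge, $z^k\to z^*$. With $\delta$, $R$, $\alpha_{L_1}$, $\alpha_{L_2}$ as defined in the context for this $z^*$ and $z^0$, set $$K:=\max\left\{4,\frac{1}{s^2\alpha_{L_1}^2}\right\}\frac{256R^2}{\delta^2}+\frac{2}{s\|A\|_2}.$$ Then for every $k>K$, $$\|z^k-z^*\|_2\le 4\delta\exp\left(-\frac{k-K}{2\left\lceil 4e/(s^2\alpha_{L_2}^2)\right\rceil}\right),$$ where $e$ is Euler's number.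
   Context: Setting: $A\in\mathbb R^{m\times n}$ is nonzero, $b\in\mathbb R^m$, $c\in\mathbb R^n$. The LP is $\min\{c^Tx: Ax=b,\ x\ge 0\}$ with primal-dual form $\min_{x\ge0}\max_{y}\; c^Tx-y^TAx+b^Ty$. The LP is feasible and bounded. An optimal (primal-dual) solution is a saddle point $z^*=(x^*,y^* )$ of the primal-dual form, i.e. $Ax^*=b$, $x^*\ge0$, $A^Ty^*\le c$, $c^Tx^*\le b^Ty^*$. PDHG with step-size $s>0$ from $z^0=(x^0,y^0)$: for $k=0,1,\dots$, $x^{k+1}=\mathrm{proj}_{\mathbb R^n_+}\left(x^k-s(c-A^Ty^k)\right)$, $\ y^{k+1}=y^k-s\left(A(2x^{k+1}-x^k)-b\right)$. Notation: $\|A\|_2$ is the operator norm, $\|\cdot\|_2$ the Euclidean norm, $A_i$ the $i$-th column of $A$, $A_J=(A_j)_{j\in J}$ for $J\subset[n]$, $[\cdot]^+$ the componentwise positive part, $\mathrm{dist}$ the Euclidean distance. Index partition of $z^*=(x^*,y^* )$: $N=\{i: c_i-A_i^Ty^*>0\}$, $B_1=\{i: c_i-A_i^Ty^*=0,\ x_i^*>0\}$, $B_2=\{i: c_i-A_i^Ty^*=0,\ x_i^*=0\}$, $B=B_1\cup B_2$. Non-degeneracy metric: $\delta=\min\left\{\min_{i\in N}\frac{c_i-A_i^Ty^*}{\|A\|_2},\ \min_{i\in B_1}x_i^*\right\}$ (a minimum over the empty set is $+\infty$). $R=2\left(\|z^0-z^*\|_2+\|z^*\|_2\right)+1$ and $R_2=\delta+\|z^*\|_2$.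 $\alpha_{L_1}>0$ is the sharpness constant of the system $A_B^Tv\le0,\ Au=0,\ u_{N\cup B_2}\ge0,\ \frac1R(c^Tu-b^Tv)\le0$: with $\mathcal K\subset\mathbb R^n\times\mathbb R^m$ its solution set, for all $(u,v)\in\mathbb R^n\times\mathbb R^m$, $$\alpha_{L_1}\,\mathrm{dist}((u,v),\mathcal K)\le\left\|\left([A_B^Tv]^+,\ Au,\ [-u_{N\cup B_2}]^+,\ \tfrac1R[c^Tu-b^Tv]^+\right)\right\|_2 .$$ $\alpha_{L_2}>0$ is the sharpness constant of the homogeneous system $A_Bu_B=0,\ u_{B_2}\ge0,\ A_B^Tv\le0,\ c_B^Tu_B-b^Tv\le0$ (residual of the last inequality scaled by $1/R_2$): with $\mathcal W^*\subset\mathbb R^{|B|}\times\mathbb R^m$ its solution set, for all $(u_B,v)\in\mathbb R^{|B|}\times\mathbb R^m$, $$\alpha_{L_2}\,\mathrm{dist}((u_B,v),\mathcal W^* )\le\left\|\left(A_Bu_B,\ [A_B^Tv]^+,\ [-u_{B_2}]^+,\ \tfrac1{R_2}[c_B^Tu_B-b^Tv]^+\right)\right\|_2 .$$ *)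

theory Defs
  imports "HOL-Analysis.Analysis"
begin

definition nonneg :: "real ^ 'n \<Rightarrow> bool" where
  "nonneg x \<longleftrightarrow> (\<forall>i. 0 \<le> x $ i)"

definition opnorm :: "real ^ 'n ^ 'm \<Rightarrow> real" where
  "opnorm A = onorm (\<lambda>x. A *v x)"


definition lp_feasible :: "real ^ 'n ^ 'm \<Rightarrow> real ^ 'm \<Rightarrow> (real ^ 'n) set" where
  "lp_feasible A b = {x. A *v x = b \<and> nonneg x}"

definition lagrangian ::
  "real ^ 'n ^ 'm \<Rightarrow> real ^ 'm \<Rightarrow> real ^ 'n \<Rightarrow> real ^ 'n \<Rightarrow> real ^ 'm \<Rightarrow> real" where
  "lagrangian A b c x y = c \<bullet> x - y \<bullet> (A *v x) + b \<bullet> y"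

definition saddle_point ::
  "real ^ 'n ^ 'm \<Rightarrow> real ^ 'm \<Rightarrow> real ^ 'n \<Rightarrow> (real ^ 'n) \<times> (real ^ 'm) \<Rightarrow> bool" where
  "saddle_point A b c = (\<lambda>(xs, ys). nonneg xs \<and>
     (\<forall>x y. nonneg x \<longrightarrow>
        lagrangian A b c xs y \<le> lagrangian A b c xs ys \<and>
        lagrangian A b c xs ys \<le> lagrangian A b c x ys))"

definition reduced_cost :: "real ^ 'n ^ 'm \<Rightarrow> real ^ 'n \<Rightarrow> real ^ 'm \<Rightarrow> real ^ 'n" where
  "reduced_cost A c y = c - transpose A *v y"

lemma saddle_point_iff:
  fixes A :: "real ^ 'n ^ 'm"
  shows "saddle_point A b c (xs, ys) \<longleftrightarrow>
     A *v xs = b \<and> nonneg xs \<and> nonneg (reduced_cost A c ys) \<and> c \<bullet> xs \<le> b \<bullet> ys"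
proof -
  have dual: "y \<bullet> (A *v x) = (transpose A *v y) \<bullet> x" for x :: "real ^ 'n" and y :: "real ^ 'm"
    by (simp add: dot_lmul_matrix flip: vector_transpose_matrix)
  have lag1: "lagrangian A b c x y = c \<bullet> x + (b - A *v x) \<bullet> y" for x y
    by (simp add: lagrangian_def inner_diff_right inner_commute[of _ y])
  have lag2: "lagrangian A b c x y = reduced_cost A c y \<bullet> x + b \<bullet> y" for x y
    unfolding lagrangian_def reduced_cost_def dual by (simp add: inner_diff_left)
  show ?thesis
  proof
    assume sp: "saddle_point A b c (xs, ys)"
    then have nn: "nonneg xs"
      and up: "\<And>y. lagrangian A b c xs y \<le> lagrangian A b c xs ys"
      and lo: "\<And>x. nonneg x \<Longrightarrow> lagrangian A b c xs ys \<le> lagrangian A b c x ys"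
      by (auto simp: saddle_point_def)
    have "(b - A *v xs) \<bullet> (b - A *v xs) \<le> 0"
      using up[of "ys + (b - A *v xs)"] by (simp add: lag1 inner_add_right)
    then have "b - A *v xs = 0"
      using inner_gt_zero_iff[of "b - A *v xs"] by linarith
    then have eq: "A *v xs = b" by simp
    have "0 \<le> reduced_cost A c ys $ i" for i
    proof -
      have "nonneg (xs + axis i 1)"
        using nn by (auto simp: nonneg_def axis_def)
      from lo[OF this] show ?thesis
        by (simp add: lag2 inner_add_right inner_axis)
    qed
    moreover have "c \<bullet> xs \<le> b \<bullet> ys"
      using lo[of 0] eq by (simp add: lag1 nonneg_def)
    ultimately show "A *v xs = b \<and> nonneg xs \<and> nonneg (reduced_cost A c ys) \<and> c \<bullet> xs \<le> b \<bullet> ys"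
      using eq nn by (simp add: nonneg_def)
  next
    assume a: "A *v xs = b \<and> nonneg xs \<and> nonneg (reduced_cost A c ys) \<and> c \<bullet> xs \<le> b \<bullet> ys"
    have "0 \<le> reduced_cost A c ys \<bullet> x" if "nonneg x" for x
      using a that by (auto simp: inner_vec_def nonneg_def intro!: sum_nonneg)
    then have "b \<bullet> ys \<le> lagrangian A b c x ys" if "nonneg x" for x
      using that by (simp add: lag2)
    moreover have "lagrangian A b c xs y = c \<bullet> xs" for y
      using a by (simp add: lag1)
    ultimately show "saddle_point A b c (xs, ys)"
      using a by (fastforce simp: saddle_point_def)
  qed
qed


definition pdhg_step ::
  "real ^ 'n ^ 'm \<Rightarrow> real ^ 'm \<Rightarrow> real ^ 'n \<Rightarrow> real \<Rightarrow>
     (real ^ 'n) \<times> (real ^ 'm) \<Rightarrow> (real ^ 'n) \<times> (real ^ 'm)" where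
  "pdhg_step A b c s = (\<lambda>(x, y).
     let x' = closest_point {w. nonneg w} (x - s *\<^sub>R (c - transpose A *v y))
     in (x', y - s *\<^sub>R (A *v (2 *\<^sub>R x' - x) - b)))"

primrec pdhg ::
  "real ^ 'n ^ 'm \<Rightarrow> real ^ 'm \<Rightarrow> real ^ 'n \<Rightarrow> real \<Rightarrow> (real ^ 'n) \<times> (real ^ 'm) \<Rightarrow>
     nat \<Rightarrow> (real ^ 'n) \<times> (real ^ 'm)" where
  "pdhg A b c s z0 0 = z0"
| "pdhg A b c s z0 (Suc k) = pdhg_step A b c s (pdhg A b c s z0 k)"


definition idx_N :: "real ^ 'n ^ 'm \<Rightarrow> real ^ 'n \<Rightarrow> (real ^ 'n) \<times> (real ^ 'm) \<Rightarrow> 'n set" where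
  "idx_N A c = (\<lambda>(x, y). {i. reduced_cost A c y $ i > 0})"

definition idx_B1 :: "real ^ 'n ^ 'm \<Rightarrow> real ^ 'n \<Rightarrow> (real ^ 'n) \<times> (real ^ 'm) \<Rightarrow> 'n set" where
  "idx_B1 A c = (\<lambda>(x, y). {i. reduced_cost A c y $ i = 0 \<and> x $ i > 0})"

definition idx_B2 :: "real ^ 'n ^ 'm \<Rightarrow> real ^ 'n \<Rightarrow> (real ^ 'n) \<times> (real ^ 'm) \<Rightarrow> 'n set" where
  "idx_B2 A c = (\<lambda>(x, y). {i. reduced_cost A c y $ i = 0 \<and> x $ i = 0})"

definition idx_B :: "real ^ 'n ^ 'm \<Rightarrow> real ^ 'n \<Rightarrow> (real ^ 'n) \<times> (real ^ 'm) \<Rightarrow> 'n set" where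
  "idx_B A c z = idx_B1 A c z \<union> idx_B2 A c z"

text \<open>The metric is extended real: an infimum over the empty set is \<open>\<infinity>\<close>, so
  it is infinite exactly when both \<open>N\<close> and \<open>B\<^sub>1\<close> are empty.\<close>

definition nondeg_metric ::
  "real ^ 'n ^ 'm \<Rightarrow> real ^ 'n \<Rightarrow> (real ^ 'n) \<times> (real ^ 'm) \<Rightarrow> ereal" where
  "nondeg_metric A c z =
     min (INF i \<in> idx_N A c z. ereal (reduced_cost A c (snd z) $ i / opnorm A))
         (INF i \<in> idx_B1 A c z. ereal (fst z $ i))"

definition R1 :: "(real ^ 'n) \<times> (real ^ 'm) \<Rightarrow> (real ^ 'n) \<times> (real ^ 'm) \<Rightarrow> real" where
  "R1 z0 zs = 2 * (norm (z0 - zs) + norm zs) + 1"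

definition R2 ::
  "real ^ 'n ^ 'm \<Rightarrow> real ^ 'n \<Rightarrow> (real ^ 'n) \<times> (real ^ 'm) \<Rightarrow> ereal" where
  "R2 A c zs = nondeg_metric A c zs + ereal (norm zs)"


text \<open>Any positive constant satisfying the error bound counts as a sharpness constant,
  not only the largest one (which need not exist: \<open>S\<close> may be all of \<open>E\<close>).\<close>

definition sharpness_constant ::
  "'a::metric_space set \<Rightarrow> 'a set \<Rightarrow> ('a \<Rightarrow> 'b::real_normed_vector) \<Rightarrow> real \<Rightarrow> bool" where
  "sharpness_constant E S res \<alpha> \<longleftrightarrow>
     \<alpha> > 0 \<and> (\<forall>w \<in> E. \<alpha> * infdist w S \<le> norm (res w))"

text \<open>The subvector of positive parts with indices in \<open>I\<close>, padded with zeros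
  outside \<open>I\<close>; the padding does not change Euclidean norms.\<close>

definition pos_part_on :: "'n set \<Rightarrow> real ^ 'n \<Rightarrow> real ^ 'n" where
  "pos_part_on I w = (\<chi> i. if i \<in> I then max 0 (w $ i) else 0)"

definition L1_solutions ::
  "real ^ 'n ^ 'm \<Rightarrow> real ^ 'm \<Rightarrow> real ^ 'n \<Rightarrow> real \<Rightarrow> (real ^ 'n) \<times> (real ^ 'm) \<Rightarrow>
     ((real ^ 'n) \<times> (real ^ 'm)) set" where
  "L1_solutions A b c R zs = {(u, v).
     (\<forall>i \<in> idx_B A c zs. (transpose A *v v) $ i \<le> 0) \<and>
     A *v u = 0 \<and>
     (\<forall>i \<in> idx_N A c zs \<union> idx_B2 A c zs. u $ i \<ge> 0) \<and>
     (1 / R) * (c \<bullet> u - b \<bullet> v) \<le> 0}"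

definition L1_residual ::
  "real ^ 'n ^ 'm \<Rightarrow> real ^ 'm \<Rightarrow> real ^ 'n \<Rightarrow> real \<Rightarrow> (real ^ 'n) \<times> (real ^ 'm) \<Rightarrow>
     (real ^ 'n) \<times> (real ^ 'm) \<Rightarrow> (real ^ 'n) \<times> (real ^ 'm) \<times> (real ^ 'n) \<times> real" where
  "L1_residual A b c R zs = (\<lambda>(u, v).
     (pos_part_on (idx_B A c zs) (transpose A *v v),
      A *v u,
      pos_part_on (idx_N A c zs \<union> idx_B2 A c zs) (- u),
      (1 / R) * max 0 (c \<bullet> u - b \<bullet> v)))"

text \<open>A vector \<open>u\<^sub>B\<close> indexed by \<open>B\<close> is encoded as a vector of full length vanishing
  outside \<open>B\<close>; this identification is isometric.\<close>

definition L2_space ::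
  "real ^ 'n ^ 'm \<Rightarrow> real ^ 'n \<Rightarrow> (real ^ 'n) \<times> (real ^ 'm) \<Rightarrow>
     ((real ^ 'n) \<times> (real ^ 'm)) set" where
  "L2_space A c zs = {(u, v). \<forall>i. i \<notin> idx_B A c zs \<longrightarrow> u $ i = 0}"

definition L2_solutions ::
  "real ^ 'n ^ 'm \<Rightarrow> real ^ 'm \<Rightarrow> real ^ 'n \<Rightarrow> (real ^ 'n) \<times> (real ^ 'm) \<Rightarrow>
     ((real ^ 'n) \<times> (real ^ 'm)) set" where
  "L2_solutions A b c zs = {(u, v). (u, v) \<in> L2_space A c zs \<and>
     (\<Sum>i \<in> idx_B A c zs. u $ i *\<^sub>R column i A) = 0 \<and>
     (\<forall>i \<in> idx_B2 A c zs. u $ i \<ge> 0) \<and>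
     (\<forall>i \<in> idx_B A c zs. (transpose A *v v) $ i \<le> 0) \<and>
     (\<Sum>i \<in> idx_B A c zs. c $ i * u $ i) - b \<bullet> v \<le> 0}"

text \<open>If \<open>R2\<close> is infinite, the factor \<open>1 / R2\<close> is \<open>0\<close>.\<close>

definition L2_residual ::
  "real ^ 'n ^ 'm \<Rightarrow> real ^ 'm \<Rightarrow> real ^ 'n \<Rightarrow> (real ^ 'n) \<times> (real ^ 'm) \<Rightarrow>
     (real ^ 'n) \<times> (real ^ 'm) \<Rightarrow> (real ^ 'm) \<times> (real ^ 'n) \<times> (real ^ 'n) \<times> real" where
  "L2_residual A b c zs = (\<lambda>(u, v).
     ((\<Sum>i \<in> idx_B A c zs. u $ i *\<^sub>R column i A),
      pos_part_on (idx_B A c zs) (transpose A *v v),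
      pos_part_on (idx_B2 A c zs) (- u),
      real_of_ereal (1 / R2 A c zs) *
        max 0 ((\<Sum>i \<in> idx_B A c zs. c $ i * u $ i) - b \<bullet> v)))"

text \<open>At an optimal solution the metric is positive, so the quotient below is finite
  (it is \<open>0\<close> if the metric is infinite).\<close>

definition pdhg_K ::
  "real ^ 'n ^ 'm \<Rightarrow> real ^ 'n \<Rightarrow> real \<Rightarrow> real \<Rightarrow> real \<Rightarrow> (real ^ 'n) \<times> (real ^ 'm) \<Rightarrow> real" where
  "pdhg_K A c s \<alpha> R zs =
     max 4 (1 / (s\<^sup>2 * \<alpha>\<^sup>2)) * real_of_ereal (ereal (256 * R\<^sup>2) / (nondeg_metric A c zs)\<^sup>2)
       + 2 / (s * opnorm A)"

end

theory Submission imports Defs begin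

text \<open>
  One step of PDHG satisfies the inclusion \<open>Q (z\<^sup>k - z\<^sup>k\<^sup>+\<^sup>1) / s \<in> F (z\<^sup>k\<^sup>+\<^sup>1)\<close> for the monotone
  operator \<open>F\<close> of the saddle point problem, where \<open>Q = I + s [0, A\<^sup>T; A, 0]\<close> has spectrum in
  \<open>[1/2, 3/2]\<close>. Hence the iterates are Fejer monotone in the \<open>Q\<close>-norm \<open>sqrt q\<close> with respect to all
  optimal solutions, the displacements decrease, and \<open>q (z\<^sup>k - z\<^sup>k\<^sup>+\<^sup>1)\<close> is \<open>O(1/k)\<close>; it bounds the
  residuals of both sharpness systems.

  Vectors \<open>w\<close> of norm at most \<open>\<delta>\<close> in either solution cone are directions for which \<open>z\<^sup>* + w\<close> is
  optimal. By the first sharpness inequality a late iterate is close to \<open>z\<^sup>*\<close> plus the cone; as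
  the limit is \<open>z\<^sup>*\<close>, Fejer monotonicity then excludes a shell around \<open>z\<^sup>*\<close>, and since the steps are
  too short to cross it, the iterates are already within \<open>\<delta> / 5\<close> of \<open>z\<^sup>*\<close>. There the reduced
  costs on \<open>N\<close> exceed \<open>4 \<delta> \<parallel>A\<parallel> / 5\<close>, which drives \<open>x\<^sub>N\<close> to zero in at most
  \<open>1 / (4 s \<parallel>A\<parallel>) + 1\<close> further steps. From then on the second sharpness inequality bounds the
  distance to the cone by the displacement, and summing the Fejer inequality over a block
  of \<open>4 e / (s\<^sup>2 \<alpha>\<^sup>2)\<close> steps contracts this distance by \<open>exp (- 1/2)\<close>.
\<close>

section \<open>Projection onto the orthant, transposes and the operator norm\<close>

declare transpose_matrix_vector [simp del]

text \<open>The orthant is a product of half-lines, so a nearest point can be chosen coordinate by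
  coordinate; this makes \<open>pdhg_step\<close> explicit.\<close>

lemma closest_point_nonneg:
  fixes x :: "real ^ 'n"
  shows "closest_point {w. nonneg w} x = (\<chi> i. max 0 (x $ i))"
proof (rule sym, rule closest_point_unique)
  show "convex {w::real ^ 'n. nonneg w}"
    by (auto simp: convex_def nonneg_def)
  show "closed {w::real ^ 'n. nonneg w}"
    unfolding nonneg_def by (intro closed_Collect_all closed_Collect_le continuous_intros)
  show "(\<chi> i. max 0 (x $ i)) \<in> {w. nonneg w}"
    by (simp add: nonneg_def)
  show "\<forall>z\<in>{w. nonneg w}. dist x (\<chi> i. max 0 (x $ i)) \<le> dist x z"
    by (auto simp: dist_norm nonneg_def max_def intro!: norm_le_componentwise_cart)
       (smt (verit))
qed

lemma transpose_inner:
  fixes A :: "real ^ 'n ^ 'm"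
  shows "(transpose A *v y) \<bullet> x = y \<bullet> (A *v x)" "x \<bullet> (transpose A *v y) = y \<bullet> (A *v x)"
proof -
  show "(transpose A *v y) \<bullet> x = y \<bullet> (A *v x)"
    by (simp add: dot_lmul_matrix flip: vector_transpose_matrix)
  then show "x \<bullet> (transpose A *v y) = y \<bullet> (A *v x)"
    by (simp add: inner_commute)
qed

lemma norm_mult_le_opnorm: "norm (A *v x) \<le> opnorm A * norm x"
  unfolding opnorm_def by (rule onorm[OF matrix_vector_mul_bounded_linear])

text \<open>A component is the inner product of \<open>y\<close> with a column of \<open>A\<close>,
  which is the image of a unit vector under \<open>A\<close>.\<close>

lemma abs_transpose_component_le:
  fixes A :: "real ^ 'n ^ 'm"
  shows "\<bar>(transpose A *v y) $ i\<bar> \<le> opnorm A * norm y"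
proof -
  have "(transpose A *v y) $ i = y \<bullet> (A *v axis i 1)"
    by (simp flip: transpose_inner(1) add: inner_axis)
  also have "\<bar>\<dots>\<bar> \<le> norm y * norm (A *v axis i 1)"
    by (rule Cauchy_Schwarz_ineq2)
  also have "\<dots> \<le> norm y * (opnorm A * norm (axis i (1::real)))"
    by (intro mult_left_mono norm_mult_le_opnorm) simp
  finally show ?thesis by (simp add: mult.commute)
qed

lemma opnorm_pos: "A \<noteq> 0 \<Longrightarrow> opnorm A > 0"
  unfolding opnorm_def onorm_pos_lt[OF matrix_vector_mul_bounded_linear]
  by (metis matrix_eq matrix_vector_mult_0)

lemma norm_Pair_power2: "(norm (x, y))\<^sup>2 = (norm x)\<^sup>2 + (norm y)\<^sup>2"
  by (simp add: norm_Pair)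

lemma fst_pdhg_step:
  "fst (pdhg_step A b c s z) $ i = max 0 ((fst z - s *\<^sub>R reduced_cost A c (snd z)) $ i)"
  by (simp add: pdhg_step_def closest_point_nonneg Let_def reduced_cost_def split: prod.split)

lemma snd_pdhg_step:
  "snd (pdhg_step A b c s z) =
     snd z - s *\<^sub>R (A *v (2 *\<^sub>R fst (pdhg_step A b c s z) - fst z) - b)"
  by (simp add: pdhg_step_def Let_def split: prod.split)

section \<open>Index partition and complementary slackness\<close>

lemma idx_cases:
  assumes "saddle_point A b c zs"
  obtains "i \<in> idx_N A c zs" | "i \<in> idx_B1 A c zs" | "i \<in> idx_B2 A c zs"
  using assms
  by (cases zs) (auto simp: saddle_point_iff nonneg_def idx_N_def idx_B1_def idx_B2_def less_le)

lemma saddle_point_gap: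
  assumes "A *v x = b"
  shows "c \<bullet> x - b \<bullet> y = reduced_cost A c y \<bullet> x"
  using assms by (simp add: reduced_cost_def inner_diff_left transpose_inner inner_commute[of b])

text \<open>The duality gap is a sum of nonnegative products of reduced costs and primal components;
  optimality makes the sum at most zero, so each product vanishes.\<close>

lemma saddle_point_complementary:
  assumes "saddle_point A b c zs"
  shows "reduced_cost A c (snd zs) $ i * fst zs $ i = 0"
    and "c \<bullet> fst zs = b \<bullet> snd zs"
proof -
  obtain x y where zs: "zs = (x, y)" by fastforce
  have sp: "A *v x = b" "nonneg x" "nonneg (reduced_cost A c y)" "c \<bullet> x \<le> b \<bullet> y"
    using assms by (auto simp: zs saddle_point_iff)
  have nn: "0 \<le> reduced_cost A c y $ j * x $ j" for j
    using sp by (simp add: nonneg_def)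
  have le: "(\<Sum>j\<in>UNIV. reduced_cost A c y $ j * x $ j) \<le> 0"
    using saddle_point_gap[OF sp(1), of c y] sp(4) by (simp add: inner_vec_def)
  with nn have "(\<Sum>j\<in>UNIV. reduced_cost A c y $ j * x $ j) = 0"
    by (simp add: order_antisym sum_nonneg)
  then have "\<forall>j\<in>UNIV. reduced_cost A c y $ j * x $ j = 0" "reduced_cost A c y \<bullet> x = 0"
    using sum_nonneg_eq_0_iff[of UNIV "\<lambda>j. reduced_cost A c y $ j * x $ j"] nn
    by (simp_all add: inner_vec_def del: mult_eq_0_iff)
  then show "reduced_cost A c (snd zs) $ i * fst zs $ i = 0" "c \<bullet> fst zs = b \<bullet> snd zs"
    using saddle_point_gap[OF sp(1), of c y] by (simp_all add: zs del: mult_eq_0_iff)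
qed

section \<open>The solution cones of the two sharpness systems\<close>

text \<open>Closedness provides an element of the cone nearest to a given iterate.\<close>

lemma closed_L1_solutions: "closed (L1_solutions A b c R zs)"
proof -
  have "L1_solutions A b c R zs = {w.
     (\<forall>i \<in> idx_B A c zs. (transpose A *v snd w) $ i \<le> 0) \<and> A *v fst w = 0 \<and>
     (\<forall>i \<in> idx_N A c zs \<union> idx_B2 A c zs. 0 \<le> fst w $ i) \<and>
     (1 / R) * (c \<bullet> fst w - b \<bullet> snd w) \<le> 0}"
    by (auto simp: L1_solutions_def)
  also have "closed \<dots>"
    unfolding Ball_def
    by (intro closed_Collect_conj closed_Collect_all closed_Collect_imp open_Collect_const
        closed_Collect_le closed_Collect_eq continuous_intros
        linear_continuous_on_compose[OF _ matrix_vector_mul_linear])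
  finally show ?thesis .
qed

lemma closed_L2_solutions: "closed (L2_solutions A b c zs)"
proof -
  have "L2_solutions A b c zs = {w.
     (\<forall>i. i \<notin> idx_B A c zs \<longrightarrow> fst w $ i = 0) \<and>
     (\<Sum>i \<in> idx_B A c zs. fst w $ i *\<^sub>R column i A) = 0 \<and>
     (\<forall>i \<in> idx_B2 A c zs. 0 \<le> fst w $ i) \<and>
     (\<forall>i \<in> idx_B A c zs. (transpose A *v snd w) $ i \<le> 0) \<and>
     (\<Sum>i \<in> idx_B A c zs. c $ i * fst w $ i) - b \<bullet> snd w \<le> 0}"
    by (auto simp: L2_solutions_def L2_space_def)
  also have "closed \<dots>"
    unfolding Ball_def
    by (intro closed_Collect_conj closed_Collect_all closed_Collect_imp open_Collect_const
        closed_Collect_le closed_Collect_eq continuous_intros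
        linear_continuous_on_compose[OF _ matrix_vector_mul_linear])
  finally show ?thesis .
qed

text \<open>Padding with zeros turns the products restricted to \<open>B\<close> into full ones, so
  a single residual estimate serves both sharpness systems.\<close>

lemma sum_idx_B:
  fixes A :: "real ^ 'n ^ 'm"
  assumes "(u, v) \<in> L2_space A c zs"
  shows "(\<Sum>i \<in> idx_B A c zs. u $ i *\<^sub>R column i A) = A *v u"
    and "(\<Sum>i \<in> idx_B A c zs. c $ i * u $ i) = c \<bullet> u"
proof -
  have z: "u $ i = 0" if "i \<notin> idx_B A c zs" for i
    using assms that by (simp add: L2_space_def)
  show "(\<Sum>i \<in> idx_B A c zs. u $ i *\<^sub>R column i A) = A *v u"
    unfolding matrix_mult_sum scalar_mult_eq_scaleR
    by (rule sum.mono_neutral_left) (auto simp: z)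
  show "(\<Sum>i \<in> idx_B A c zs. c $ i * u $ i) = c \<bullet> u"
    unfolding inner_vec_def inner_real_def
    by (rule sum.mono_neutral_left) (auto simp: z)
qed

text \<open>Transfers perturbation results for the first cone to the second, whose elements vanish
  on \<open>N\<close>.\<close>

lemma L2_solutions_subset:
  assumes "saddle_point A b c zs" and "R > 0"
  shows "L2_solutions A b c zs \<subseteq> L1_solutions A b c R zs"
proof clarify
  fix u v assume w: "(u, v) \<in> L2_solutions A b c zs"
  then have sp: "(u, v) \<in> L2_space A c zs" by (simp add: L2_solutions_def)
  have "u $ i = 0" if "i \<in> idx_N A c zs" for i
    using sp that by (auto simp: L2_space_def idx_N_def idx_B_def idx_B1_def idx_B2_def)
  then show "(u, v) \<in> L1_solutions A b c R zs"
    using w sum_idx_B[OF sp] \<open>R > 0\<close>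
    by (auto simp: L2_solutions_def L1_solutions_def divide_le_0_iff)
qed

section \<open>The quadratic form of the step\<close>

locale pdhg_lp =
  fixes A :: "real ^ 'n ^ 'm" and b :: "real ^ 'm" and c :: "real ^ 'n" and s :: real
  assumes s_pos: "0 < s" and s_opnorm: "s * opnorm A \<le> 1 / 2"
begin

definition Q :: "(real ^ 'n) \<times> (real ^ 'm) \<Rightarrow> (real ^ 'n) \<times> (real ^ 'm)" where
  "Q z = (fst z + s *\<^sub>R (transpose A *v snd z), snd z + s *\<^sub>R (A *v fst z))"

definition q :: "(real ^ 'n) \<times> (real ^ 'm) \<Rightarrow> real" where
  "q z = Q z \<bullet> z"

abbreviation step :: "(real ^ 'n) \<times> (real ^ 'm) \<Rightarrow> (real ^ 'n) \<times> (real ^ 'm)" where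
  "step \<equiv> pdhg_step A b c s"

lemma Q_add: "Q (z + w) = Q z + Q w"
  by (simp add: Q_def matrix_vector_right_distrib scaleR_add_right)

lemma Q_scaleR: "Q (t *\<^sub>R z) = t *\<^sub>R Q z"
  by (simp add: Q_def scaleR_add_right linear_cmul[OF matrix_vector_mul_linear])

lemma Q_sym: "Q z \<bullet> w = Q w \<bullet> z"
  by (cases z; cases w)
     (simp add: Q_def inner_add_left transpose_inner(1), simp add: inner_commute algebra_simps)

lemma q_uminus: "q (- z) = q z"
  using Q_scaleR[of "-1" z] by (simp add: q_def)

lemma q_scaleR: "q (t *\<^sub>R z) = t\<^sup>2 * q z"
  by (simp add: q_def Q_scaleR power2_eq_square)

lemma q_add: "q (z + w) = q z + 2 * (Q z \<bullet> w) + q w"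
  by (simp add: q_def Q_add inner_add_left inner_add_right Q_sym[of w z])

lemma q_eq: "q z = (norm z)\<^sup>2 + 2 * s * (snd z \<bullet> (A *v fst z))"
  by (cases z) (simp add: q_def Q_def inner_add_left transpose_inner norm_Pair_power2
      power2_norm_eq_inner inner_commute[of "A *v _"])

text \<open>By Cauchy-Schwarz and \<open>s_opnorm\<close> the cross term of \<open>q_eq\<close> is
  at most the product of the norms of the two components, hence at most half of the squared
  norm.\<close>

lemma q_bounds: "(norm z)\<^sup>2 \<le> 2 * q z" "q z \<le> 3 / 2 * (norm z)\<^sup>2"
proof -
  define a where "a = norm (fst z)"
  define d where "d = norm (snd z)"
  have z: "(norm z)\<^sup>2 = a\<^sup>2 + d\<^sup>2"
    by (cases z) (simp add: a_def d_def norm_Pair_power2)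
  have "\<bar>snd z \<bullet> (A *v fst z)\<bar> \<le> d * norm (A *v fst z)"
    unfolding d_def by (rule Cauchy_Schwarz_ineq2)
  also have "\<dots> \<le> d * (opnorm A * a)"
    unfolding a_def d_def by (intro mult_left_mono norm_mult_le_opnorm) simp
  finally have "s * \<bar>snd z \<bullet> (A *v fst z)\<bar> \<le> s * (d * (opnorm A * a))"
    using s_pos by (simp add: mult_left_mono)
  also have "\<dots> = (s * opnorm A) * (a * d)" by simp
  also have "\<dots> \<le> 1 / 2 * (a * d)"
    using s_opnorm by (intro mult_right_mono) (auto simp: a_def d_def)
  also have "\<dots> \<le> 1 / 2 * ((a\<^sup>2 + d\<^sup>2) / 2)"
    using sum_squares_bound[of a d] by simp
  finally have "\<bar>2 * s * (snd z \<bullet> (A *v fst z))\<bar> \<le> (a\<^sup>2 + d\<^sup>2) / 2"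
    using s_pos by (simp add: abs_mult)
  then show "(norm z)\<^sup>2 \<le> 2 * q z" "q z \<le> 3 / 2 * (norm z)\<^sup>2"
    unfolding q_eq z by (auto simp: abs_le_iff)
qed

lemma q_nonneg: "0 \<le> q z"
  using q_bounds(1)[of z] zero_le_power2[of "norm z"] by linarith

text \<open>Expanding \<open>q (z - t Q z) \<ge> 0\<close> at the optimal \<open>t = 2 / 3\<close>.\<close>

lemma norm_Q_le: "(norm (Q z))\<^sup>2 \<le> 3 / 2 * q z"
proof -
  define g where "g = (norm (Q z))\<^sup>2"
  have "0 \<le> q (z + (- (2/3)) *\<^sub>R Q z)"
    by (rule q_nonneg)
  also have "\<dots> = q z - 4/3 * g + 4/9 * q (Q z)"
    unfolding q_add q_scaleR by (simp add: g_def power2_norm_eq_inner power_divide)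
  also have "\<dots> \<le> q z - 4/3 * g + 4/9 * (3 / 2 * g)"
    using q_bounds(2)[of "Q z"] unfolding g_def by simp
  finally show ?thesis unfolding g_def by simp
qed

section \<open>One PDHG step as a firmly nonexpansive map\<close>

text \<open>The projection is firmly nonexpansive in each coordinate; the extrapolated dual update
  supplies exactly the terms that complete the \<open>Q\<close>-inner product.\<close>

lemma step_firmly_nonexpansive:
  "0 \<le> Q ((z - w) - (step z - step w)) \<bullet> (step z - step w)"
proof -
  define e where "e = z - w"
  define f where "f = step z - step w"
  have snd_f: "snd e - snd f = s *\<^sub>R (A *v (2 *\<^sub>R fst f - fst e))"
    unfolding e_def f_def snd_diff fst_diff
    by (subst (1 2) snd_pdhg_step)
       (simp add: matrix_vector_mult_diff_distrib algebra_simps)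
  define gz where "gz = fst z - s *\<^sub>R reduced_cost A c (snd z)"
  define gw where "gw = fst w - s *\<^sub>R reduced_cost A c (snd w)"
  have g: "gz - gw = fst e + s *\<^sub>R (transpose A *v snd e)"
    unfolding gz_def gw_def e_def
    by (simp add: reduced_cost_def matrix_vector_mult_diff_distrib algebra_simps)
  have "0 \<le> (gz - gw - fst f) \<bullet> fst f"
    unfolding inner_vec_def
  proof (intro sum_nonneg, simp)
    fix i
    have "fst f $ i = max 0 (gz $ i) - max 0 (gw $ i)"
      by (simp add: f_def fst_pdhg_step gz_def gw_def)
    then show "0 \<le> (gz $ i - gw $ i - fst f $ i) * fst f $ i"
      by (auto simp: max_def mult_nonneg_nonneg mult_nonpos_nonpos mult_nonneg_nonpos
          zero_le_mult_iff)
  qed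
  also have "\<dots> = (fst e - fst f) \<bullet> fst f + s * (snd e \<bullet> (A *v fst f))"
    by (simp add: g inner_diff_left inner_add_left transpose_inner)
  \<comment> \<open>By \<open>snd_f\<close>, \<open>s\<close> times \<open>A *v fst f\<close> equals
    \<open>snd e - snd f\<close> plus \<open>s\<close> times \<open>A *v (fst e - fst f)\<close>;
    this is paired with \<open>snd f\<close>.\<close>
  also have "\<dots> = (fst e - fst f) \<bullet> fst f + s * ((snd e - snd f) \<bullet> (A *v fst f))
      + (snd e - snd f) \<bullet> snd f + s * ((A *v (fst e - fst f)) \<bullet> snd f)"
    by (subst (2) snd_f)
       (simp add: matrix_vector_mult_diff_distrib linear_cmul[OF matrix_vector_mul_linear]
         inner_diff_left inner_commute algebra_simps)
  also have "\<dots> = Q (e - f) \<bullet> f"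
    by (cases e; cases f)
       (simp add: Q_def inner_add_left transpose_inner)
  finally show ?thesis unfolding e_def f_def .
qed

lemma step_saddle_point:
  assumes "saddle_point A b c p"
  shows "step p = p"
proof -
  obtain x y where p: "p = (x, y)" by fastforce
  have sp: "A *v x = b" "nonneg x" "nonneg (reduced_cost A c y)"
    using assms by (auto simp: p saddle_point_iff)
  have "fst (step p) $ i = x $ i" for i
  proof (cases "x $ i = 0")
    case True
    with sp s_pos show ?thesis
      by (auto simp: fst_pdhg_step p nonneg_def)
  next
    case False
    with saddle_point_complementary(1)[OF assms, of i] have "reduced_cost A c y $ i = 0"
      by (simp add: p)
    with sp show ?thesis by (simp add: fst_pdhg_step p nonneg_def)
  qed
  then have x: "fst (step p) = x" by (simp add: vec_eq_iff)
  then have "snd (step p) = y"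
    using sp by (simp add: snd_pdhg_step p scaleR_2)
  with x show ?thesis by (simp add: p prod_eq_iff)
qed

text \<open>Since \<open>p\<close> is a fixed point, firm nonexpansiveness makes the cross term in
  the expansion of \<open>q (z - p)\<close> nonnegative.\<close>

lemma step_fejer:
  assumes "saddle_point A b c p"
  shows "q (step z - p) + q (z - step z) \<le> q (z - p)"
proof -
  have "0 \<le> Q (z - step z) \<bullet> (step z - p)"
    using step_firmly_nonexpansive[of z p] by (simp add: step_saddle_point[OF assms])
  then show ?thesis
    using q_add[of "z - step z" "step z - p"] by simp
qed

text \<open>Firm nonexpansiveness for the pair \<open>z\<close>, \<open>step z\<close>.\<close>

lemma step_displacement: "q (step z - step (step z)) \<le> q (z - step z)"
proof -
  define d where "d = z - step z"
  define f where "f = step z - step (step z)"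
  have "0 \<le> Q (d - f) \<bullet> f"
    using step_firmly_nonexpansive[of z "step z"] by (simp add: d_def f_def)
  moreover have "q d = q (d - f) + 2 * (Q (d - f) \<bullet> f) + q f"
    using q_add[of "d - f" f] by simp
  ultimately show ?thesis
    using q_nonneg[of "d - f"] unfolding d_def f_def by linarith
qed

text \<open>The vector \<open>Q (z - step z) / s\<close> is the residual of the optimality conditions
  at \<open>step z\<close>.\<close>

lemma step_residual:
  fixes z
  defines "r \<equiv> Q (z - step z)"
  shows "s *\<^sub>R (A *v fst (step z) - b) = snd r"
    and "s * (- reduced_cost A c (snd (step z)) $ i) \<le> - fst r $ i"
    and "s * (c \<bullet> fst (step z) - b \<bullet> snd (step z)) = step z \<bullet> r"
proof -
  define x' where "x' = fst (step z)"
  define y' where "y' = snd (step z)"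
  define g where "g = fst z - s *\<^sub>R reduced_cost A c (snd z)"
  have x'i: "x' $ i = max 0 (g $ i)" for i
    by (simp add: x'_def g_def fst_pdhg_step)
  have y': "y' = snd z - s *\<^sub>R (A *v (2 *\<^sub>R x' - fst z) - b)"
    unfolding x'_def y'_def by (rule snd_pdhg_step)
  have st: "step z = (x', y')" by (simp add: x'_def y'_def)
  have r1: "fst r = (g - x') + s *\<^sub>R reduced_cost A c y'"
    by (simp add: r_def Q_def st g_def reduced_cost_def matrix_vector_mult_diff_distrib
        algebra_simps)
  have "A *v (2 *\<^sub>R x' - fst z) - b = (A *v x' - b) - A *v (fst z - x')"
    unfolding scaleR_2 matrix_vector_right_distrib matrix_vector_mult_diff_distrib
    by (simp add: algebra_simps)
  then have r2: "snd r = s *\<^sub>R (A *v x' - b)"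
    by (simp add: r_def Q_def st y' flip: scaleR_add_right)
  show "s *\<^sub>R (A *v fst (step z) - b) = snd r"
    by (simp add: r2 st)
  show "s * (- reduced_cost A c (snd (step z)) $ i) \<le> - fst r $ i"
    by (simp add: r1 st x'i)
  \<comment> \<open>Complementarity of the projection: where \<open>x'\<close> is nonzero it equals
    \<open>g\<close>. Hence pairing the residual with \<open>step z\<close> leaves only the duality
    gap.\<close>
  have "x' \<bullet> (g - x') = 0"
    unfolding inner_vec_def by (intro sum.neutral) (auto simp: x'i max_def)
  moreover have "x' \<bullet> reduced_cost A c y' + y' \<bullet> (A *v x' - b) = c \<bullet> x' - b \<bullet> y'"
    by (simp add: reduced_cost_def inner_diff_right transpose_inner inner_commute[of x']
        inner_diff_left inner_commute[of b])
  ultimately have "step z \<bullet> r = s * (c \<bullet> x' - b \<bullet> y')"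
    by (cases r) (use r1 r2 in \<open>simp add: st inner_add_right flip: distrib_left\<close>)
  then show "s * (c \<bullet> fst (step z) - b \<bullet> snd (step z)) = step z \<bullet> r"
    by (simp add: st)
qed

section \<open>Residuals and distance to the cones\<close>

text \<open>\<open>\<rho>\<close> stands for the scaling of the gap row in either system. As
  \<open>s\<close> times the gap is \<open>step z \<bullet> r\<close>, the scaled row costs at most
  \<open>norm r\<close>; the other two rows together cost the same, so the constant is 2 times the
  3/2 of \<open>norm_Q_le\<close>.\<close>

lemma residual_bound:
  fixes z
  assumes sp: "saddle_point A b c zs" and \<rho>: "0 \<le> \<rho>" "\<rho> * norm (step z) \<le> 1"
  defines "w \<equiv> step z - zs"
  shows "s\<^sup>2 * ((norm (pos_part_on (idx_B A c zs) (transpose A *v snd w)))\<^sup>2 +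
     (norm (A *v fst w))\<^sup>2 + (\<rho> * max 0 (c \<bullet> fst w - b \<bullet> snd w))\<^sup>2) \<le> 3 * q (z - step z)"
proof -
  define r where "r = Q (z - step z)"
  obtain x y where zs: "zs = (x, y)" by fastforce
  have Ax: "A *v x = b" and gap: "c \<bullet> x = b \<bullet> y"
    using sp saddle_point_complementary(2)[OF sp] by (auto simp: zs saddle_point_iff)
  have "norm (s *\<^sub>R pos_part_on (idx_B A c zs) (transpose A *v snd w)) \<le> norm (fst r)"
  proof (rule norm_le_componentwise_cart)
    fix i
    have "s * (transpose A *v snd w) $ i \<le> - fst r $ i" if "i \<in> idx_B A c zs"
    proof -
      have "reduced_cost A c y $ i = 0"
        using that by (auto simp: zs idx_B_def idx_B1_def idx_B2_def)
      then have "(transpose A *v snd w) $ i = - reduced_cost A c (snd (step z)) $ i"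
        by (simp add: w_def zs reduced_cost_def matrix_vector_mult_diff_distrib)
      then show ?thesis
        using step_residual(2)[of z i] by (simp add: r_def)
    qed
    then show "norm ((s *\<^sub>R pos_part_on (idx_B A c zs) (transpose A *v snd w)) $ i)
        \<le> norm (fst r $ i)"
      using s_pos by (auto simp: pos_part_on_def max_def abs_mult)
  qed
  then have 1: "(s * norm (pos_part_on (idx_B A c zs) (transpose A *v snd w)))\<^sup>2 \<le> (norm (fst r))\<^sup>2"
    using s_pos by (simp add: power_mono)
  have "s *\<^sub>R (A *v fst w) = snd r"
    using step_residual(1)[of z] by (simp add: w_def zs Ax r_def matrix_vector_mult_diff_distrib)
  then have "norm (snd r) = s * norm (A *v fst w)"
    using s_pos by (metis abs_of_pos norm_scaleR)
  then have 2: "(s * norm (A *v fst w))\<^sup>2 = (norm (snd r))\<^sup>2"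
    by simp
  have "s * (c \<bullet> fst w - b \<bullet> snd w) = step z \<bullet> r"
    using step_residual(3)[of z] by (simp add: w_def zs r_def inner_diff_right gap algebra_simps)
  also have "\<dots> \<le> norm (step z) * norm r"
    by (rule norm_cauchy_schwarz)
  finally have "s * max 0 (c \<bullet> fst w - b \<bullet> snd w) \<le> norm (step z) * norm r"
    by (auto simp: max_def)
  then have "\<rho> * (s * max 0 (c \<bullet> fst w - b \<bullet> snd w)) \<le> \<rho> * (norm (step z) * norm r)"
    using \<rho>(1) by (rule mult_left_mono)
  also have "\<dots> \<le> norm r"
    using mult_right_mono[OF \<rho>(2), of "norm r"] by (simp add: mult.assoc)
  finally have 3: "(s * (\<rho> * max 0 (c \<bullet> fst w - b \<bullet> snd w)))\<^sup>2 \<le> (norm r)\<^sup>2"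
    using s_pos \<rho>(1) by (intro power_mono) (auto simp: mult_ac)
  have "(norm r)\<^sup>2 = (norm (fst r))\<^sup>2 + (norm (snd r))\<^sup>2"
    by (cases r) (simp add: norm_Pair_power2)
  moreover have "(norm r)\<^sup>2 \<le> 3 / 2 * q (z - step z)"
    unfolding r_def by (rule norm_Q_le)
  ultimately show ?thesis
    using 1 2 3 by (simp add: power_mult_distrib distrib_left)
qed

lemma infdist_L1_solutions_le:
  assumes sp: "saddle_point A b c zs"
    and sharp: "sharpness_constant UNIV (L1_solutions A b c R zs) (L1_residual A b c R zs) \<alpha>"
    and R: "0 < R" "norm (step z) \<le> R"
  shows "s\<^sup>2 * \<alpha>\<^sup>2 * (infdist (step z - zs) (L1_solutions A b c R zs))\<^sup>2 \<le> 3 * q (z - step z)"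
proof -
  define w where "w = step z - zs"
  \<comment> \<open>On these indices \<open>zs\<close> vanishes while the step lands in the orthant,
    so the sign row of the residual is zero.\<close>
  have "pos_part_on (idx_N A c zs \<union> idx_B2 A c zs) (- fst w) = 0"
  proof -
    have "fst w $ i \<ge> 0" if "i \<in> idx_N A c zs \<union> idx_B2 A c zs" for i
    proof -
      have "fst zs $ i = 0"
        using that saddle_point_complementary(1)[OF sp, of i]
        by (cases zs) (auto simp: idx_N_def idx_B2_def)
      then show ?thesis by (simp add: w_def fst_pdhg_step)
    qed
    then show ?thesis by (auto simp: pos_part_on_def vec_eq_iff max_def intro: antisym)
  qed
  then have res: "(norm (L1_residual A b c R zs w))\<^sup>2 =
      (norm (pos_part_on (idx_B A c zs) (transpose A *v snd w)))\<^sup>2 +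
     (norm (A *v fst w))\<^sup>2 + ((1 / R) * max 0 (c \<bullet> fst w - b \<bullet> snd w))\<^sup>2"
    by (cases w) (simp add: L1_residual_def norm_Pair_power2 del: times_divide_eq_left)
  have "\<alpha> * infdist w (L1_solutions A b c R zs) \<le> norm (L1_residual A b c R zs w)" "\<alpha> > 0"
    using sharp unfolding sharpness_constant_def by blast+
  then have "(\<alpha> * infdist w (L1_solutions A b c R zs))\<^sup>2 \<le> (norm (L1_residual A b c R zs w))\<^sup>2"
    by (intro power_mono) (auto simp: infdist_nonneg)
  then have "s\<^sup>2 * (\<alpha> * infdist w (L1_solutions A b c R zs))\<^sup>2 \<le> s\<^sup>2 * (norm (L1_residual A b c R zs w))\<^sup>2"
    by (intro mult_left_mono) auto
  also have "\<dots> \<le> 3 * q (z - step z)"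
    using residual_bound[OF sp, of "1 / R" z, folded w_def] R by (simp add: res)
  finally show ?thesis by (simp add: w_def power_mult_distrib mult.assoc)
qed

lemma infdist_L2_solutions_le:
  assumes sp: "saddle_point A b c zs" and metric: "nondeg_metric A c zs = ereal \<delta>" "0 < \<delta>"
    and sharp: "sharpness_constant (L2_space A c zs) (L2_solutions A b c zs) (L2_residual A b c zs) \<alpha>"
    and R: "norm (step z) \<le> \<delta> + norm zs"
    and N: "\<And>i. i \<in> idx_N A c zs \<Longrightarrow> fst (step z) $ i = 0"
  shows "s\<^sup>2 * \<alpha>\<^sup>2 * (infdist (step z - zs) (L2_solutions A b c zs))\<^sup>2 \<le> 3 * q (z - step z)"
proof -
  define w where "w = step z - zs"
  have N0: "fst zs $ i = 0" if "i \<in> idx_N A c zs \<union> idx_B2 A c zs" for i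
    using that saddle_point_complementary(1)[OF sp, of i]
    by (cases zs) (auto simp: idx_N_def idx_B2_def)
  \<comment> \<open>Outside \<open>B\<close>, that is on \<open>N\<close>, both points vanish. The
    second sharpness inequality holds only on this subspace.\<close>
  have space: "w \<in> L2_space A c zs"
  proof -
    have "fst w $ i = 0" if "i \<notin> idx_B A c zs" for i
      using idx_cases[OF sp, of i]
      by cases (use that N[of i] N0[of i] in \<open>simp_all add: w_def idx_B_def\<close>)
    then show ?thesis by (cases w) (simp add: L2_space_def)
  qed
  have "pos_part_on (idx_B2 A c zs) (- fst w) = 0"
    using N0 by (auto simp: pos_part_on_def vec_eq_iff max_def w_def fst_pdhg_step)
  moreover have "real_of_ereal (1 / R2 A c zs) = 1 / (\<delta> + norm zs)"
    using metric by (simp add: R2_def one_ereal_def add_pos_nonneg less_imp_neq[symmetric])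
  ultimately have res: "(norm (L2_residual A b c zs w))\<^sup>2 =
      (norm (pos_part_on (idx_B A c zs) (transpose A *v snd w)))\<^sup>2 +
     (norm (A *v fst w))\<^sup>2 + ((1 / (\<delta> + norm zs)) * max 0 (c \<bullet> fst w - b \<bullet> snd w))\<^sup>2"
    using sum_idx_B[of "fst w" "snd w" A c zs] space
    by (cases w) (simp add: L2_residual_def norm_Pair_power2 del: times_divide_eq_left)
  have "\<alpha> * infdist w (L2_solutions A b c zs) \<le> norm (L2_residual A b c zs w)" "\<alpha> > 0"
    using sharp space by (auto simp: sharpness_constant_def)
  then have "(\<alpha> * infdist w (L2_solutions A b c zs))\<^sup>2 \<le> (norm (L2_residual A b c zs w))\<^sup>2"
    by (intro power_mono) (auto simp: infdist_nonneg)
  then have "s\<^sup>2 * (\<alpha> * infdist w (L2_solutions A b c zs))\<^sup>2 \<le> s\<^sup>2 * (norm (L2_residual A b c zs w))\<^sup>2"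
    by (intro mult_left_mono) auto
  also have "\<dots> \<le> 3 * q (z - step z)"
    using residual_bound[OF sp, of "1 / (\<delta> + norm zs)" z, folded w_def] R metric
    by (simp add: res add_pos_nonneg)
  finally show ?thesis by (simp add: w_def power_mult_distrib mult.assoc)
qed

end

section \<open>Converging iterates and optimal perturbations of the limit\<close>

locale pdhg_converging = pdhg_lp A b c s
  for A :: "real ^ 'n ^ 'm" and b :: "real ^ 'm" and c :: "real ^ 'n" and s :: real +
  fixes z0 zs :: "(real ^ 'n) \<times> (real ^ 'm)" and \<delta> :: real
  assumes opnorm_A: "0 < opnorm A"
    and saddle: "saddle_point A b c zs"
    and converges: "pdhg A b c s z0 \<longlonglongrightarrow> zs"
    and metric: "nondeg_metric A c zs = ereal \<delta>" and \<delta>_pos: "0 < \<delta>"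
begin

definition z :: "nat \<Rightarrow> (real ^ 'n) \<times> (real ^ 'm)" where
  "z = pdhg A b c s z0"

lemma z_0: "z 0 = z0" and z_Suc: "z (Suc k) = step (z k)"
  by (simp_all add: z_def)

lemma z_limit: "z \<longlonglongrightarrow> zs"
  using converges by (simp add: z_def)

lemma \<delta>_N: "\<delta> * opnorm A \<le> reduced_cost A c (snd zs) $ i" if "i \<in> idx_N A c zs"
proof -
  have "ereal \<delta> \<le> (INF i \<in> idx_N A c zs. ereal (reduced_cost A c (snd zs) $ i / opnorm A))"
    unfolding metric[symmetric] nondeg_metric_def by simp
  also have "\<dots> \<le> ereal (reduced_cost A c (snd zs) $ i / opnorm A)"
    using that by (rule INF_lower)
  finally show ?thesis using opnorm_A by (simp add: pos_le_divide_eq)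
qed

lemma \<delta>_B1: "\<delta> \<le> fst zs $ i" if "i \<in> idx_B1 A c zs"
proof -
  have "ereal \<delta> \<le> (INF i \<in> idx_B1 A c zs. ereal (fst zs $ i))"
    unfolding metric[symmetric] nondeg_metric_def by simp
  also have "\<dots> \<le> ereal (fst zs $ i)"
    using that by (rule INF_lower)
  finally show ?thesis by simp
qed

text \<open>The sign constraints that the cone omits have slack at \<open>zs\<close>:
  \<open>x\<close> is at least \<delta> on \<open>B1\<close>, and the reduced costs are at least
  \<open>\<delta> * opnorm A\<close> on \<open>N\<close>. A move of norm at most \<delta> cannot use
  up either slack.\<close>

lemma saddle_point_perturb:
  assumes w: "w \<in> L1_solutions A b c R zs" "norm w \<le> \<delta>" and R: "0 < R"
  shows "saddle_point A b c (zs + w)"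
proof -
  obtain x y where zs: "zs = (x, y)" by fastforce
  obtain u v where uv: "w = (u, v)" by fastforce
  have sp: "A *v x = b" "nonneg x" "nonneg (reduced_cost A c y)" "c \<bullet> x \<le> b \<bullet> y"
    using saddle by (auto simp: zs saddle_point_iff)
  have B: "\<And>i. i \<in> idx_B A c zs \<Longrightarrow> (transpose A *v v) $ i \<le> 0" and Au: "A *v u = 0"
    and NB: "\<And>i. i \<in> idx_N A c zs \<union> idx_B2 A c zs \<Longrightarrow> u $ i \<ge> 0"
    and gap: "c \<bullet> u - b \<bullet> v \<le> 0"
    using w(1) R by (auto simp: uv L1_solutions_def divide_le_0_iff)
  have u: "\<bar>u $ i\<bar> \<le> \<delta>" for i
    using w(2) component_le_norm_cart[of u i] norm_fst_le[of u v] by (simp add: uv)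
  have "\<bar>(transpose A *v v) $ i\<bar> \<le> opnorm A * norm v" for i
    by (rule abs_transpose_component_le)
  moreover have "opnorm A * norm v \<le> opnorm A * \<delta>"
    using w(2) norm_snd_le[of v u] opnorm_A by (intro mult_left_mono) (auto simp: uv)
  ultimately have v: "\<bar>(transpose A *v v) $ i\<bar> \<le> \<delta> * opnorm A" for i
    by (metis mult.commute order_trans)
  have "0 \<le> x $ i + u $ i" for i
    using idx_cases[OF saddle, of i]
  proof cases
    case 2
    then show ?thesis using \<delta>_B1[of i] u[of i] by (simp add: zs)
  qed (use sp(2) NB[of i] in \<open>auto simp: nonneg_def\<close>)
  moreover have "0 \<le> reduced_cost A c (y + v) $ i" for i
  proof -
    have rc: "reduced_cost A c (y + v) $ i = reduced_cost A c y $ i - (transpose A *v v) $ i"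
      by (simp add: reduced_cost_def matrix_vector_right_distrib)
    show ?thesis
      using idx_cases[OF saddle, of i]
    proof cases
      case 1
      then show ?thesis using \<delta>_N[of i] v[of i] by (simp add: zs rc)
    qed (use sp(3) B[of i] in \<open>auto simp: rc nonneg_def idx_B_def intro: order_trans\<close>)
  qed
  ultimately show ?thesis
    using sp Au gap
    by (simp add: zs uv saddle_point_iff nonneg_def matrix_vector_right_distrib inner_add_right)
qed

section \<open>Fejer descent along the iterates\<close>

text \<open>Telescoping \<open>step_fejer\<close> gives a sum of \<open>Suc m\<close> displacements;
  since these decrease, each can be replaced by the last one.\<close>

lemma q_descent:
  assumes "saddle_point A b c p"
  shows "real (Suc m) * q (z (k + m) - z (Suc (k + m))) + q (z (Suc (k + m)) - p) \<le> q (z k - p)"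
proof (induction m)
  case 0
  then show ?case using step_fejer[OF assms, of "z k"] by (simp add: z_Suc)
next
  case (Suc m)
  have "real (Suc m) * q (z (Suc (k + m)) - z (Suc (Suc (k + m))))
      \<le> real (Suc m) * q (z (k + m) - z (Suc (k + m)))"
    using step_displacement[of "z (k + m)"] by (intro mult_left_mono) (auto simp: z_Suc)
  moreover have "q (z (Suc (Suc (k + m))) - p) + q (z (Suc (k + m)) - z (Suc (Suc (k + m))))
      \<le> q (z (Suc (k + m)) - p)"
    using step_fejer[OF assms, of "z (Suc (k + m))"] by (simp add: z_Suc)
  ultimately show ?case
    using Suc by (simp add: algebra_simps)
qed

lemma q_mono:
  assumes "saddle_point A b c p"
  shows "q (z (k + m) - p) \<le> q (z k - p)"
proof (cases m)
  case (Suc n)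
  then show ?thesis
    using q_descent[OF assms, of n k] q_nonneg[of "z (k + n) - z (Suc (k + n))"]
    by (smt (verit) add_Suc_right mult_nonneg_nonneg of_nat_0_le_iff)
qed simp

lemma q_limit_le:
  assumes "saddle_point A b c p"
  shows "q (zs - p) \<le> q (z k - p)"
proof (rule LIMSEQ_le_const2)
  have "isCont (\<lambda>w. q (w - p)) zs"
    unfolding q_eq by (intro continuous_intros linear_continuous_compose[OF _ matrix_vector_mul_linear])
  then show "(\<lambda>n. q (z n - p)) \<longlonglongrightarrow> q (zs - p)"
    using z_limit by (rule isCont_tendsto_compose)
  show "\<exists>N. \<forall>n\<ge>N. q (z n - p) \<le> q (z k - p)"
    using q_mono[OF assms, of k] by (metis le_Suc_ex)
qed

lemma zero_in_solutions: "0 \<in> L1_solutions A b c R zs" "0 \<in> L2_solutions A b c zs"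
  by (simp_all add: L1_solutions_def L2_solutions_def L2_space_def zero_prod_def)

text \<open>The factor is \<open>sqrt 3\<close> from \<open>q_bounds\<close>, rounded up. It
  explains the 2 in \<open>R1\<close>, which thereby bounds the norms of all iterates.\<close>

lemma norm_diff_le: "norm (z k - zs) \<le> 2 * norm (z0 - zs)"
proof (rule power2_le_imp_le)
  have four: "(2 * norm (z0 - zs))\<^sup>2 = 4 * (norm (z0 - zs))\<^sup>2"
    by (simp add: power_mult_distrib)
  have "(norm (z k - zs))\<^sup>2 \<le> 2 * q (z k - zs)"
    by (rule q_bounds)
  also have "\<dots> \<le> 2 * q (z0 - zs)"
    using q_mono[OF saddle, of 0 k] by (simp add: z_0)
  also have "\<dots> \<le> 2 * (3 / 2 * (norm (z0 - zs))\<^sup>2)"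
    by (intro mult_left_mono q_bounds) simp
  finally show "(norm (z k - zs))\<^sup>2 \<le> (2 * norm (z0 - zs))\<^sup>2"
    using zero_le_power2[of "norm (z0 - zs)"] four by linarith
qed simp

text \<open>Fejer monotonicity with respect to the optimal solution \<open>zs + w\<close> bounds the distance
  of the limit from \<open>zs + w\<close>.\<close>

lemma norm_le_of_perturb:
  assumes "saddle_point A b c (zs + w)"
  shows "(norm (z (k + m) - zs - w))\<^sup>2 \<le> 3 * (norm (z k - zs - w))\<^sup>2"
    and "(norm w)\<^sup>2 \<le> 3 * (norm (z k - zs - w))\<^sup>2"
proof -
  have le: "2 * q (z k - (zs + w)) \<le> 3 * (norm (z k - zs - w))\<^sup>2"
    using q_bounds(2)[of "z k - (zs + w)"] by (simp add: diff_diff_eq)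
  have "(norm (z (k + m) - zs - w))\<^sup>2 \<le> 2 * q (z (k + m) - (zs + w))"
    using q_bounds(1)[of "z (k + m) - (zs + w)"] by (simp add: diff_diff_eq)
  then show "(norm (z (k + m) - zs - w))\<^sup>2 \<le> 3 * (norm (z k - zs - w))\<^sup>2"
    using q_mono[OF assms, of k m] le by linarith
  have "(norm w)\<^sup>2 \<le> 2 * q (zs - (zs + w))"
    using q_bounds(1)[of w] by (simp add: q_uminus)
  then show "(norm w)\<^sup>2 \<le> 3 * (norm (z k - zs - w))\<^sup>2"
    using q_limit_le[OF assms, of k] le by linarith
qed

lemma q_displacement_le:
  "real (Suc k) * q (z k - z (Suc k)) \<le> 3 / 2 * (norm (z0 - zs))\<^sup>2"
  using q_descent[OF saddle, of k 0] q_nonneg[of "z (Suc k) - zs"] q_bounds(2)[of "z0 - zs"]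
  by (simp add: z_0)

section \<open>Reaching the neighbourhood of the limit and clearing \<open>N\<close>\<close>

lemma R1_pos: "0 < R1 z0 zs"
  by (simp add: R1_def add_nonneg_pos)

text \<open>Close to \<open>zs\<close>, the point of the local cone nearest to an iterate is an optimal solution,
  and Fejer monotonicity ties the limit \<open>zs\<close> to it. So once the steps are short, the iterates
  cannot cross the shell between the radii \<open>\<delta> / 5\<close> and \<open>\<delta> / 2\<close>.\<close>

lemma near_dichotomy:
  assumes sharp: "sharpness_constant UNIV (L1_solutions A b c (R1 z0 zs) zs)
      (L1_residual A b c (R1 z0 zs) zs) \<alpha>"
    and M: "4 \<le> M" "1 \<le> M * (s\<^sup>2 * \<alpha>\<^sup>2)"
    and k: "M * (256 * (R1 z0 zs)\<^sup>2 / \<delta>\<^sup>2) \<le> real (Suc k)"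
  shows "norm (z k - z (Suc k)) \<le> \<delta> / 10"
    and "norm (z (Suc k) - zs) \<le> \<delta> / 2 \<Longrightarrow> norm (z (Suc k) - zs) \<le> \<delta> / 5"
proof -
  define R where "R = R1 z0 zs"
  define p where "p = q (z k - z (Suc k))"
  have R: "0 < R" "2 * norm (z0 - zs) \<le> R" "2 * norm (z0 - zs) + norm zs \<le> R"
    using R1_pos by (auto simp: R_def R1_def)
  have p0: "0 \<le> p" by (simp add: p_def q_nonneg)
  have sq: "(\<delta> / 10)\<^sup>2 = \<delta>\<^sup>2 / 100" "(\<delta> / 15)\<^sup>2 = \<delta>\<^sup>2 / 225"
    by (simp_all add: power_divide)
  have "real (Suc k) * p \<le> 3 / 2 * (norm (z0 - zs))\<^sup>2"
    unfolding p_def by (rule q_displacement_le)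
  also have "\<dots> \<le> 3 / 2 * (R / 2)\<^sup>2"
    using R by (intro mult_left_mono power_mono) auto
  finally have "M * (256 * R\<^sup>2 / \<delta>\<^sup>2) * p \<le> 3 / 2 * (R / 2)\<^sup>2"
    using mult_right_mono[OF k[folded R_def] p0] by linarith
  then have "R\<^sup>2 * (M * 256 * p) \<le> R\<^sup>2 * (3 / 8 * \<delta>\<^sup>2)"
    using \<delta>_pos by (simp add: field_simps power2_eq_square)
  \<comment> \<open>\<open>R\<close> cancels, leaving 3/8 divided by 256.\<close>
  then have Mp: "M * p \<le> 3 / 2048 * \<delta>\<^sup>2"
    using R(1) by simp
  have "4 * p \<le> M * p"
    using M(1) p0 by (rule mult_right_mono)
  moreover have "(norm (z k - z (Suc k)))\<^sup>2 \<le> 2 * p"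
    unfolding p_def by (rule q_bounds)
  ultimately have "(norm (z k - z (Suc k)))\<^sup>2 \<le> (\<delta> / 10)\<^sup>2"
    using Mp zero_le_power2[of \<delta>] sq by linarith
  then show "norm (z k - z (Suc k)) \<le> \<delta> / 10"
    by (rule power2_le_imp_le) (use \<delta>_pos in simp)
  assume near: "norm (z (Suc k) - zs) \<le> \<delta> / 2"
  have ne: "L1_solutions A b c R zs \<noteq> {}"
    using zero_in_solutions(1) by auto
  obtain w where w: "w \<in> L1_solutions A b c R zs"
    and dist: "infdist (z (Suc k) - zs) (L1_solutions A b c R zs) = dist (z (Suc k) - zs) w"
    using infdist_attains_inf[OF closed_L1_solutions ne] by metis
  define h where "h = norm (z (Suc k) - zs - w)"
  have "norm (z (Suc k)) \<le> R"
    using norm_triangle_ineq[of "z (Suc k) - zs" zs] norm_diff_le[of "Suc k"] R(3) by simp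
  then have "s\<^sup>2 * \<alpha>\<^sup>2 * h\<^sup>2 \<le> 3 * p"
    using infdist_L1_solutions_le[OF saddle sharp[folded R_def] R(1), of "z k"] dist
    by (simp add: z_Suc h_def p_def dist_norm)
  then have "M * (s\<^sup>2 * \<alpha>\<^sup>2) * h\<^sup>2 \<le> 3 * (M * p)"
    using M(1) mult_left_mono[of _ _ M] by (simp add: mult_ac)
  moreover have "h\<^sup>2 \<le> M * (s\<^sup>2 * \<alpha>\<^sup>2) * h\<^sup>2"
    using mult_right_mono[OF M(2), of "h\<^sup>2"] by simp
  \<comment> \<open>The square of \<open>h\<close> is at most \<open>3 * (M * p)\<close>, and
    \<open>9 / 2048 < 1 / 225\<close>.\<close>
  ultimately have "h\<^sup>2 \<le> (\<delta> / 15)\<^sup>2"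
    using Mp zero_le_power2[of \<delta>] sq by linarith
  then have h: "h \<le> \<delta> / 15"
    by (rule power2_le_imp_le) (use \<delta>_pos in simp)
  have "norm w \<le> norm (z (Suc k) - zs) + h"
    unfolding h_def using norm_triangle_ineq4[of "z (Suc k) - zs" "z (Suc k) - zs - w"] by simp
  then have "norm w \<le> \<delta>"
    using near h \<delta>_pos by simp
  then have "(norm w)\<^sup>2 \<le> 3 * h\<^sup>2"
    unfolding h_def by (intro norm_le_of_perturb saddle_point_perturb[OF w _ R(1)])
  also have "\<dots> \<le> (2 * h)\<^sup>2"
    by (simp add: power_mult_distrib)
  finally have "norm w \<le> 2 * h"
    by (rule power2_le_imp_le) (simp add: h_def)
  \<comment> \<open>The distance is at most \<open>h + 2 * h\<close>, which is why \<open>h\<close>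
    had to be below \<open>\<delta> / 15\<close>.\<close>
  then show "norm (z (Suc k) - zs) \<le> \<delta> / 5"
    using h norm_triangle_ineq[of "z (Suc k) - zs - w" w] by (simp add: h_def)
qed

text \<open>Backward induction from an index where convergence already gives the bound: one step
  back the distance is at most \<open>\<delta> / 5 + \<delta> / 10\<close>, below
  \<open>\<delta> / 2\<close>, and the dichotomy improves it to \<open>\<delta> / 5\<close>. As the
  dichotomy concerns results of a step, \<open>j\<close> is positive.\<close>

lemma eventually_near:
  assumes sharp: "sharpness_constant UNIV (L1_solutions A b c (R1 z0 zs) zs)
      (L1_residual A b c (R1 z0 zs) zs) \<alpha>"
    and M: "4 \<le> M" "1 \<le> M * (s\<^sup>2 * \<alpha>\<^sup>2)"
    and j: "M * (256 * (R1 z0 zs)\<^sup>2 / \<delta>\<^sup>2) \<le> real j" "0 < j"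
  shows "norm (z j - zs) \<le> \<delta> / 5"
proof -
  obtain n0 where n0: "\<And>n. n \<ge> n0 \<Longrightarrow> norm (z n - zs) < \<delta> / 5"
    using LIMSEQ_D[OF z_limit, of "\<delta> / 5"] \<delta>_pos by auto
  have "j \<le> max j n0" by simp
  then show ?thesis
  proof (induction rule: inc_induct)
    case base
    then show ?case using n0[of "max j n0"] by simp
  next
    case (step n)
    then obtain k where k: "n = Suc k"
      using j(2) by (cases n) auto
    have le: "M * (256 * (R1 z0 zs)\<^sup>2 / \<delta>\<^sup>2) \<le> real (Suc k)"
      "M * (256 * (R1 z0 zs)\<^sup>2 / \<delta>\<^sup>2) \<le> real (Suc n)"
      using j(1) step(1) k by linarith+
    have "norm (z n - zs) \<le> norm (z n - z (Suc n)) + norm (z (Suc n) - zs)"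
      using norm_triangle_ineq[of "z n - z (Suc n)" "z (Suc n) - zs"] by simp
    then have "norm (z n - zs) \<le> \<delta> / 2"
      using near_dichotomy(1)[OF sharp M le(2)] step.IH \<delta>_pos by linarith
    then show ?case
      using near_dichotomy(2)[OF sharp M le(1)] by (simp add: k)
  qed
qed

text \<open>A component starts at most at \<open>\<delta> / 5\<close>, and each step lowers it by
  \<open>4 / 5 * (s * opnorm A) * \<delta>\<close> until it reaches zero.\<close>

lemma eventually_N_zero:
  assumes near: "\<And>j. n \<le> j \<Longrightarrow> norm (z j - zs) \<le> \<delta> / 5"
    and i: "i \<in> idx_N A c zs" and m: "1 \<le> 4 * (s * opnorm A) * real m" and j: "n + m \<le> j"
  shows "fst (z j) $ i = 0"
proof -
  have decrease: "fst (z (Suc l)) $ i \<le> max 0 (fst (z l) $ i - 4 / 5 * (s * opnorm A) * \<delta>)"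
    if "n \<le> l" for l
  proof -
    have "reduced_cost A c (snd (z l)) $ i =
        reduced_cost A c (snd zs) $ i - (transpose A *v (snd (z l - zs))) $ i"
      by (simp add: reduced_cost_def matrix_vector_mult_diff_distrib)
    moreover have "(transpose A *v (snd (z l - zs))) $ i \<le> opnorm A * norm (snd (z l - zs))"
      using abs_transpose_component_le[of A "snd (z l - zs)" i] by linarith
    moreover have "opnorm A * norm (snd (z l - zs)) \<le> opnorm A * (\<delta> / 5)"
      using opnorm_A near[OF that] norm_snd_le[of "snd (z l - zs)" "fst (z l - zs)"]
      by (intro mult_left_mono) (auto simp del: fst_diff snd_diff)
    ultimately have "4 / 5 * (opnorm A * \<delta>) \<le> reduced_cost A c (snd (z l)) $ i"
      using \<delta>_N[OF i] by (simp add: mult.commute)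
    from mult_left_mono[OF this, of s]
    have "4 / 5 * (s * opnorm A) * \<delta> \<le> s * reduced_cost A c (snd (z l)) $ i"
      using s_pos by (simp add: mult_ac)
    then show ?thesis
      unfolding z_Suc fst_pdhg_step by (intro max.mono) auto
  qed
  have bound: "fst (z (n + l)) $ i \<le> max 0 (\<delta> / 5 - real l * (4 / 5 * (s * opnorm A) * \<delta>))" for l
  proof (induction l)
    case 0
    have "fst zs $ i = 0"
      using i saddle_point_complementary(1)[OF saddle, of i] by (cases zs) (auto simp: idx_N_def)
    then have "fst (z n) $ i \<le> norm (fst (z n - zs))"
      using component_le_norm_cart[of "fst (z n - zs)" i] by simp
    also have "\<dots> \<le> norm (z n - zs)"
      by (metis norm_fst_le prod.collapse)
    finally show ?case using near[of n] by simp
  next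
    case (Suc l)
    define g where "g = 4 / 5 * (s * opnorm A) * \<delta>"
    have "0 \<le> g"
      using s_pos opnorm_A \<delta>_pos by (simp add: g_def)
    moreover have "real (Suc l) * g = real l * g + g"
      by (simp add: distrib_right)
    ultimately show ?case
      using decrease[of "n + l"] Suc unfolding g_def[symmetric] add_Suc_right by linarith
  qed
  have "1 \<le> 4 * (s * opnorm A) * real (j - n)"
  proof -
    have "4 * (s * opnorm A) * real m \<le> 4 * (s * opnorm A) * real (j - n)"
      using j s_pos opnorm_A by (intro mult_left_mono) auto
    with m show ?thesis by (rule order_trans)
  qed
  then have "\<delta> / 5 * 1 \<le> \<delta> / 5 * (4 * (s * opnorm A) * real (j - n))"
    using \<delta>_pos by (intro mult_left_mono) linarith+
  then have le: "fst (z j) $ i \<le> 0"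
    using bound[of "j - n"] j by (simp add: max_def mult_ac split: if_splits)
  \<comment> \<open>Some step precedes \<open>j\<close>, so the projection yields nonnegativity;
    \<open>z0\<close> itself may lie outside the orthant.\<close>
  have "0 < m"
    using m by (cases m) auto
  then obtain l where "j = Suc l"
    using j by (cases j) auto
  then show ?thesis
    using le by (simp add: z_Suc fst_pdhg_step)
qed

section \<open>Linear convergence near the limit\<close>

text \<open>The cone contains 0, so a nearest element has at most twice the norm of
  \<open>z n - zs\<close>, short enough for a perturbation.\<close>

lemma nearest_L2_solution:
  assumes near: "norm (z n - zs) \<le> \<delta> / 5"
  obtains w where "w \<in> L2_solutions A b c zs" "saddle_point A b c (zs + w)"
    "infdist (z n - zs) (L2_solutions A b c zs) = norm (z n - zs - w)"
proof -
  have ne: "L2_solutions A b c zs \<noteq> {}"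
    using zero_in_solutions(2) by auto
  obtain w where w: "w \<in> L2_solutions A b c zs"
    and dist: "infdist (z n - zs) (L2_solutions A b c zs) = norm (z n - zs - w)"
    using infdist_attains_inf[OF closed_L2_solutions ne] by (metis dist_norm)
  have "norm (z n - zs - w) \<le> norm (z n - zs)"
    using infdist_le[OF zero_in_solutions(2), of "z n - zs"] by (simp add: dist dist_norm)
  then have "norm w \<le> \<delta>"
    using norm_triangle_ineq4[of "z n - zs" "z n - zs - w"] near \<delta>_pos by simp
  then have "saddle_point A b c (zs + w)"
    using w L2_solutions_subset[OF saddle zero_less_one] by (intro saddle_point_perturb[of w 1]) auto
  then show thesis
    using w dist that by blast
qed

text \<open>The contraction factor comes from \<open>4 e / 3 + 1 / 2 \<ge> 3 e / 2\<close>, that is, \<open>e \<le> 3\<close>.\<close>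

lemma infdist_contracts:
  assumes sharp: "sharpness_constant (L2_space A c zs) (L2_solutions A b c zs) (L2_residual A b c zs) \<alpha>"
    and near: "\<And>j. n \<le> j \<Longrightarrow> norm (z j - zs) \<le> \<delta> / 5"
    and N: "\<And>i j. i \<in> idx_N A c zs \<Longrightarrow> n \<le> j \<Longrightarrow> fst (z j) $ i = 0"
    and T: "4 * exp 1 \<le> real T * (s\<^sup>2 * \<alpha>\<^sup>2)"
  shows "infdist (z (n + T) - zs) (L2_solutions A b c zs)
      \<le> exp (- 1 / 2) * infdist (z n - zs) (L2_solutions A b c zs)" (is "?D' \<le> _ * ?D")
proof -
  have "T \<noteq> 0"
  proof
    assume "T = 0"
    with T show False using exp_gt_zero[of "1::real"] by simp
  qed
  then obtain m where m: "T = Suc m"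
    using not0_implies_Suc by auto
  define p where "p = q (z (n + m) - z (Suc (n + m)))"
  \<comment> \<open>One optimal point \<open>zs + w\<close>, chosen at the start of the block, is
    the reference for the whole block.\<close>
  obtain w where w: "w \<in> L2_solutions A b c zs" and sp: "saddle_point A b c (zs + w)"
    and D: "?D = norm (z n - zs - w)"
    using nearest_L2_solution[OF near[OF order_refl]] by blast
  have "norm (z (Suc (n + m))) \<le> \<delta> + norm zs"
    using norm_triangle_ineq[of "z (Suc (n + m)) - zs" zs] near[of "Suc (n + m)"] \<delta>_pos by simp
  then have "s\<^sup>2 * \<alpha>\<^sup>2 * ?D'\<^sup>2 \<le> 3 * p"
    using infdist_L2_solutions_le[OF saddle metric \<delta>_pos sharp, of "z (n + m)"] N[of _ "Suc (n + m)"]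
    by (simp add: p_def m z_Suc)
  from mult_left_mono[OF this, of "real T"]
  have "real T * (s\<^sup>2 * \<alpha>\<^sup>2) * ?D'\<^sup>2 \<le> 3 * (real T * p)"
    by (simp only: mult_ac of_nat_0_le_iff)
  moreover have "4 * exp 1 * ?D'\<^sup>2 \<le> real T * (s\<^sup>2 * \<alpha>\<^sup>2) * ?D'\<^sup>2"
    using T by (rule mult_right_mono) simp
  moreover have "real T * p + q (z (n + T) - (zs + w)) \<le> q (z n - (zs + w))"
    using q_descent[OF sp, of m n] by (simp add: m p_def)
  moreover have "?D'\<^sup>2 \<le> (norm (z (n + T) - (zs + w)))\<^sup>2"
    using infdist_le[OF w, of "z (n + T) - zs"]
    by (intro power_mono) (auto simp: infdist_nonneg dist_norm diff_diff_eq)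
  moreover have "(norm (z (n + T) - (zs + w)))\<^sup>2 \<le> 2 * q (z (n + T) - (zs + w))"
    by (rule q_bounds)
  moreover have "q (z n - (zs + w)) \<le> 3 / 2 * ?D\<^sup>2"
    unfolding D using q_bounds(2)[of "z n - (zs + w)"] by (simp add: diff_diff_eq)
  moreover have "exp 1 * ?D'\<^sup>2 \<le> 3 * ?D'\<^sup>2"
    using exp_le by (intro mult_right_mono) auto
  ultimately have "exp 1 * ?D'\<^sup>2 \<le> ?D\<^sup>2"
    by linarith
  from mult_left_mono[OF this, of "exp (- 1)"] have "?D'\<^sup>2 \<le> exp (- 1) * ?D\<^sup>2"
    by (simp add: mult.assoc[symmetric] flip: exp_add)
  also have "exp (- 1 :: real) = (exp (- 1 / 2))\<^sup>2"
    by (simp flip: exp_double)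
  also have "\<dots> * ?D\<^sup>2 = (exp (- 1 / 2) * ?D)\<^sup>2"
    by (simp only: power_mult_distrib)
  finally show ?thesis
    by (rule power2_le_imp_le) (simp add: infdist_nonneg)
qed

text \<open>Both the later iterates and the limit stay within \<open>sqrt 3\<close>, hence 2, times
  the distance from the optimal point nearest at time \<open>n\<close>.\<close>

lemma norm_diff_le_infdist:
  assumes near: "norm (z n - zs) \<le> \<delta> / 5"
  shows "norm (z (n + m) - zs) \<le> 4 * infdist (z n - zs) (L2_solutions A b c zs)"
proof -
  obtain w where sp: "saddle_point A b c (zs + w)"
    and D: "infdist (z n - zs) (L2_solutions A b c zs) = norm (z n - zs - w)"
    using nearest_L2_solution[OF near] by blast
  have "3 * (norm (z n - zs - w))\<^sup>2 \<le> (2 * norm (z n - zs - w))\<^sup>2"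
    by (simp add: power_mult_distrib)
  then have "norm (z (n + m) - zs - w) \<le> 2 * norm (z n - zs - w)"
    "norm w \<le> 2 * norm (z n - zs - w)"
    using norm_le_of_perturb[OF sp, of n] by (meson order_trans power2_le_imp_le norm_ge_zero
        mult_nonneg_nonneg zero_le_numeral)+
  then show ?thesis
    using norm_triangle_ineq[of "z (n + m) - zs - w" w] by (simp add: D)
qed

lemma local_linear_convergence:
  assumes sharp: "sharpness_constant (L2_space A c zs) (L2_solutions A b c zs) (L2_residual A b c zs) \<alpha>"
    and near: "\<And>j. n \<le> j \<Longrightarrow> norm (z j - zs) \<le> \<delta> / 5"
    and N: "\<And>i j. i \<in> idx_N A c zs \<Longrightarrow> n \<le> j \<Longrightarrow> fst (z j) $ i = 0"
    and T: "4 * exp 1 \<le> real T * (s\<^sup>2 * \<alpha>\<^sup>2)" "0 < T" and k: "n \<le> k"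
  shows "norm (z k - zs) \<le> 2 * \<delta> * exp (- (real k - real n) / (2 * real T))"
proof -
  \<comment> \<open>The number of complete blocks of length \<open>T\<close>.\<close>
  define j where "j = (k - n) div T"
  have decay: "infdist (z (n + l * T) - zs) (L2_solutions A b c zs) \<le> exp (- real l / 2) * (\<delta> / 5)" for l
  proof (induction l)
    case 0
    show ?case
      using infdist_le[OF zero_in_solutions(2), of "z n - zs"] near[of n] by (simp add: dist_norm)
  next
    case (Suc l)
    have "infdist (z (n + l * T + T) - zs) (L2_solutions A b c zs)
        \<le> exp (- 1 / 2) * infdist (z (n + l * T) - zs) (L2_solutions A b c zs)"
      using near N by (intro infdist_contracts[OF sharp _ _ T(1)]) auto
    also have "\<dots> \<le> exp (- 1 / 2) * (exp (- real l / 2) * (\<delta> / 5))"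
      using Suc by (intro mult_left_mono) auto
    also have "\<dots> = exp (- real (Suc l) / 2) * (\<delta> / 5)"
      by (simp add: add_divide_distrib flip: exp_add)
    finally show ?case by (simp add: algebra_simps)
  qed
  have "k = n + j * T + (k - n) mod T"
    using k by (simp add: j_def)
  then have "norm (z k - zs) \<le> 4 * infdist (z (n + j * T) - zs) (L2_solutions A b c zs)"
    using norm_diff_le_infdist[OF near[of "n + j * T"], of "(k - n) mod T"] by simp
  also have "\<dots> \<le> 4 * (exp (- real j / 2) * (\<delta> / 5))"
    by (intro mult_left_mono decay) simp
  also have "\<dots> \<le> \<delta> * exp (- real j / 2)"
    using \<delta>_pos by (simp add: field_simps)
  also have "\<dots> \<le> \<delta> * (2 * exp (- (real k - real n) / (2 * real T)))"
  proof (intro mult_left_mono)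
    \<comment> \<open>The incomplete last block costs a factor \<open>exp (1 / 2)\<close>, at most
      2.\<close>
    have "k - n < (j + 1) * T"
      unfolding j_def using T(2) dividend_less_div_times[of T "k - n"] by (simp add: add.commute)
    then have "real (k - n) \<le> (real j + 1) * real T"
      by (metis less_imp_le of_nat_1 of_nat_add of_nat_le_iff of_nat_mult)
    then have "- real j / 2 \<le> 1 / 2 + - (real k - real n) / (2 * real T)"
      using k T(2) by (simp add: of_nat_diff field_simps)
    then have "exp (- real j / 2) \<le> exp (1 / 2) * exp (- (real k - real n) / (2 * real T))"
      by (simp flip: exp_add)
    also have "\<dots> \<le> 2 * exp (- (real k - real n) / (2 * real T))"
      using exp_half_le2 by (intro mult_right_mono) auto
    finally show "exp (- real j / 2) \<le> 2 * exp (- (real k - real n) / (2 * real T))" .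
  qed (use \<delta>_pos in simp)
  finally show ?thesis by simp
qed

section \<open>The global rate\<close>

lemma global_rate:
  assumes sharp1: "sharpness_constant UNIV (L1_solutions A b c (R1 z0 zs) zs)
      (L1_residual A b c (R1 z0 zs) zs) \<alpha>1"
    and sharp2: "sharpness_constant (L2_space A c zs) (L2_solutions A b c zs)
      (L2_residual A b c zs) \<alpha>2"
    and k: "pdhg_K A c s \<alpha>1 (R1 z0 zs) zs < real k"
  shows "norm (z k - zs) \<le> 4 * \<delta> * exp (- (real k - pdhg_K A c s \<alpha>1 (R1 z0 zs) zs) /
      (2 * real_of_int \<lceil>4 * exp 1 / (s\<^sup>2 * \<alpha>2\<^sup>2)\<rceil>))"
proof -
  define M where "M = max 4 (1 / (s\<^sup>2 * \<alpha>1\<^sup>2))"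
  define K0 where "K0 = M * (256 * (R1 z0 zs)\<^sup>2 / \<delta>\<^sup>2)"
  define h where "h = s * opnorm A"
  define T where "T = nat \<lceil>4 * exp 1 / (s\<^sup>2 * \<alpha>2\<^sup>2)\<rceil>"
  define n where "n = nat \<lceil>K0\<rceil>"
  define m where "m = nat \<lceil>1 / (4 * h)\<rceil>"
  have pos: "0 < s\<^sup>2 * \<alpha>1\<^sup>2" "0 < s\<^sup>2 * \<alpha>2\<^sup>2"
    using s_pos sharp1 sharp2 by (auto simp: sharpness_constant_def)
  have h: "0 < h" "h \<le> 1 / 2"
    using s_pos opnorm_A s_opnorm by (auto simp: h_def)
  have K: "pdhg_K A c s \<alpha>1 (R1 z0 zs) zs = K0 + 2 / h"
    using \<delta>_pos by (simp add: pdhg_K_def metric K0_def M_def h_def)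
  have M: "4 \<le> M" "1 \<le> M * (s\<^sup>2 * \<alpha>1\<^sup>2)"
  proof -
    have "1 / (s\<^sup>2 * \<alpha>1\<^sup>2) \<le> M" by (simp add: M_def)
    then show "1 \<le> M * (s\<^sup>2 * \<alpha>1\<^sup>2)"
      unfolding pos_divide_le_eq[OF pos(1)] .
  qed (simp add: M_def)
  have K0: "0 < K0"
    using M(1) R1_pos \<delta>_pos by (simp add: K0_def)
  have n: "K0 \<le> real n" "0 < n" "real n \<le> K0 + 1"
    using K0 by (simp_all add: n_def)
  have m: "1 / (4 * h) \<le> real m" "real m \<le> 1 / (4 * h) + 1"
    using h(1) by (simp_all add: m_def)
  have m': "1 \<le> 4 * h * real m"
    using m(1) h(1) by (simp add: field_simps)
  \<comment> \<open>The two roundings up cost at most 2, hence at most \<open>1 / h\<close>;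
    together with \<open>1 / (4 * h)\<close> for clearing \<open>N\<close> this fits into the
    summand \<open>2 / h\<close> of \<open>K\<close>.\<close>
  have "2 \<le> 1 / h"
    using h by (simp add: field_simps)
  moreover have "1 / (4 * h) = (1 / h) / 4" "2 / h = 2 * (1 / h)"
    by simp_all
  ultimately have nm: "real (n + m) \<le> K0 + 2 / h"
    using n(3) m(2) h(1) by linarith
  have near: "norm (z j - zs) \<le> \<delta> / 5" if "n \<le> j" for j
    using that n by (intro eventually_near[OF sharp1 M]) (auto simp: K0_def)
  have N: "fst (z j) $ i = 0" if "i \<in> idx_N A c zs" "n + m \<le> j" for i j
    using eventually_N_zero[OF near that(1) m'[unfolded h_def] that(2)] .
  have "0 < 4 * exp 1 / (s\<^sup>2 * \<alpha>2\<^sup>2)"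
    using pos(2) by simp
  then have T: "0 < T" "real T = real_of_int \<lceil>4 * exp 1 / (s\<^sup>2 * \<alpha>2\<^sup>2)\<rceil>"
    by (simp_all add: T_def)
  then have "4 * exp 1 / (s\<^sup>2 * \<alpha>2\<^sup>2) \<le> real T"
    by simp
  then have "4 * exp 1 \<le> real T * (s\<^sup>2 * \<alpha>2\<^sup>2)"
    unfolding pos_divide_le_eq[OF pos(2)] .
  then have "norm (z k - zs) \<le> 2 * \<delta> * exp (- (real k - real (n + m)) / (2 * real T))"
    using near N T(1) nm k K
    by (intro local_linear_convergence[OF sharp2]) auto
  also have "\<dots> \<le> 4 * \<delta> * exp (- (real k - (K0 + 2 / h)) / (2 * real T))"
    using nm T(1) \<delta>_pos by (intro mult_mono) (auto simp: divide_right_mono)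
  finally show ?thesis
    by (simp add: K T(2))
qed

end

text \<open>Finiteness keeps the infimum strictly positive; over the empty set it is
  infinite.\<close>

lemma INF_pos_finite:
  fixes f :: "'a \<Rightarrow> ereal"
  assumes "finite S" and "\<And>i. i \<in> S \<Longrightarrow> 0 < f i"
  shows "0 < (INF i\<in>S. f i)"
  using assms by (induction S) (auto simp: top_ereal_def inf_min)

lemma nondeg_metric_pos:
  assumes "0 < opnorm A"
  shows "0 < nondeg_metric A c z"
  using assms
  by (auto simp: nondeg_metric_def idx_N_def idx_B1_def split: prod.splits intro!: INF_pos_finite)

theorem theorem3:
  fixes A :: "real ^ 'n ^ 'm" and b :: "real ^ 'm" and c :: "real ^ 'n"
    and s \<alpha>1 \<alpha>2 :: real and z0 zs :: "(real ^ 'n) \<times> (real ^ 'm)" and k :: nat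
  assumes "A \<noteq> 0"
    and "lp_feasible A b \<noteq> {}"
    and "bdd_below ((\<lambda>x. c \<bullet> x) ` lp_feasible A b)"
    and "0 < s" and "s \<le> 1 / (2 * opnorm A)"
    and "saddle_point A b c zs"
    and "pdhg A b c s z0 \<longlonglongrightarrow> zs"
    and "sharpness_constant UNIV (L1_solutions A b c (R1 z0 zs) zs)
           (L1_residual A b c (R1 z0 zs) zs) \<alpha>1"
    and "sharpness_constant (L2_space A c zs) (L2_solutions A b c zs)
           (L2_residual A b c zs) \<alpha>2"
    and "real k > pdhg_K A c s \<alpha>1 (R1 z0 zs) zs"
  shows "ereal (norm (pdhg A b c s z0 k - zs)) \<le>
           4 * nondeg_metric A c zs *
             ereal (exp (- (real k - pdhg_K A c s \<alpha>1 (R1 z0 zs) zs) /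
                           (2 * real_of_int \<lceil>4 * exp 1 / (s\<^sup>2 * \<alpha>2\<^sup>2)\<rceil>)))"
proof -
  have L: "0 < opnorm A"
    using assms(1) by (rule opnorm_pos)
  then have pos: "0 < nondeg_metric A c zs"
    by (rule nondeg_metric_pos)
  show ?thesis
  proof (cases "nondeg_metric A c zs")
    case (real \<delta>)
    interpret pdhg_converging A b c s z0 zs \<delta>
      using assms(4-7) L pos by unfold_locales (simp_all add: real field_simps)
    show ?thesis
      using global_rate[OF assms(8-10)] by (simp add: z_def real)
  next
    \<comment> \<open>The right-hand side is infinite.\<close>
    case PInf
    then show ?thesis by simp
  next
    case MInf
    with pos show ?thesis by simp
  qed
qed

end
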